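(* Let $n$ be a positive integer, let $a,b,c,d\in\mathbb{R}$, let $q(y,z)=a y^3+b y^2z+c yz^2+d z^3$, and let $Q_N:\mathbb{R}^n\to\mathbb{R}^n$ be the associated ring-coupled cubic polynomial map $$Q_N(x)=(q(x_1,x_n),q(x_2,x_1),\dots,q(x_n,x_{n-1})).$$ For $k\in\mathbb{R}$ put $$\begin{aligned} \Delta(k)={}&256(a-k)^{3}k^{3}-192(a-k)^{2}bdk^{2}-128(a-k)^{2}c^{2}k^{2}+144(a-k)^{2}cd^{2}k-27(a-k)^{2}d^{4}\\ &+144(a-k)b^{2}ck^{2}-6(a-k)b^{2}d^{2}k-80(a-k)bc^{2}dk+18(a-k)bcd^{3}+16(a-k)c^{4}k\\ &-4(a-k)c^{3}d^{2}-27b^{4}k^{2}+18b^{3}cdk-4b^{3}d^{3}-4b^{2}c^{3}k+b^{2}c^{2}d^{2},\\ P(k)={}&8(a-k)c-3b^{2},\\ D(k)={}&64(a-k)^{3}k-16(a-k)^{2}c^{2}+16(a-k)b^{2}c-16(a-k)^{2}bd-3b^{4},\\ R(k)={}&b^{3}+8d(a-k)^{2}-4(a-k)bc. \end{aligned}$$ If there exists $k$ with $a<k<0$ such that $$\bigl(\Delta(k)>0\ \wedge\ (P(k)>0\ \vee\ D(k)>0)\bigr)\ \vee\ \bigl(\Delta(k)=D(k)=R(k)=0\ \wedge\ P(k)>0\bigr),$$ then $Q_N$ is contracting.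
   Context: $\langle\cdot,\cdot\rangle$ is the Euclidean inner product on $\mathbb{R}^n$ and $S^{n-1}$ is the unit sphere. A homogeneous polynomial map $Q:\mathbb{R}^n\to\mathbb{R}^n$ of odd degree $2p+1$ is called contracting if $\langle Q(u),u\rangle<0$ for every $u\in S^{n-1}$. The ring network $N$ with $n$ cells has cell $i$ receiving input only from cell $i-1$ (indices modulo $n$, so cell $1$ receives input from cell $n$). *)

theory Defs
  imports "HOL-Analysis.Analysis"
begin

definition homogeneous_polynomial_map :: "nat \<Rightarrow> (real ^ 'n \<Rightarrow> real ^ 'n) \<Rightarrow> bool" where
  "homogeneous_polynomial_map m Q \<longleftrightarrow>
     polynomial_function Q \<and> (\<forall>t x. Q (t *\<^sub>R x) = t ^ m *\<^sub>R Q x)"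

definition contracting :: "(real ^ 'n \<Rightarrow> real ^ 'n) \<Rightarrow> bool" where
  "contracting Q \<longleftrightarrow>
     (\<exists>p. homogeneous_polynomial_map (2 * p + 1) Q) \<and> (\<forall>u \<in> sphere 0 1. Q u \<bullet> u < 0)"

(* The n = CARD('n) cells are numbered 1, ..., n by a bijection cell from {1..n} onto the
   index type, so that the coordinate x_i of a vector x is x $ cell i.  For n = 1 the only
   cell receives input from itself. *)

definition ring_labelling :: "(nat \<Rightarrow> 'n::finite) \<Rightarrow> bool" where
  "ring_labelling cell \<longleftrightarrow> bij_betw cell {1..CARD('n)} UNIV"

definition ring_input :: "(nat \<Rightarrow> 'n::finite) \<Rightarrow> 'n \<Rightarrow> 'n" where
  "ring_input cell j =
     (let i = inv_into {1..CARD('n)} cell j in cell (if i = 1 then CARD('n) else i - 1))"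

definition q :: "real \<Rightarrow> real \<Rightarrow> real \<Rightarrow> real \<Rightarrow> real \<Rightarrow> real \<Rightarrow> real" where
  "q a b c d y z = a * y^3 + b * y^2 * z + c * y * z^2 + d * z^3"

definition ring_map ::
  "(nat \<Rightarrow> 'n::finite) \<Rightarrow> real \<Rightarrow> real \<Rightarrow> real \<Rightarrow> real \<Rightarrow> real ^ 'n \<Rightarrow> real ^ 'n" where
  "ring_map cell a b c d x = (\<chi> j. q a b c d (x $ j) (x $ ring_input cell j))"

lemma ring_map_nth:
  fixes cell :: "nat \<Rightarrow> 'n::finite"
  assumes "ring_labelling cell" "i \<in> {1..CARD('n)}"
  shows "ring_map cell a b c d x $ cell i =
    q a b c d (x $ cell i) (x $ cell (if i = 1 then CARD('n) else i - 1))"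
proof -
  have "inv_into {1..CARD('n)} cell (cell i) = i"
    using assms unfolding ring_labelling_def by (meson bij_betw_imp_inj_on inv_into_f_f)
  then show ?thesis
    by (simp add: ring_map_def ring_input_def Let_def)
qed

(* Discriminant and auxiliary invariants of the binary quartic form
   (a-k) y^4 + b y^3 z + c y^2 z^2 + d y z^3 + k z^4. *)

definition Delta :: "real \<Rightarrow> real \<Rightarrow> real \<Rightarrow> real \<Rightarrow> real \<Rightarrow> real" where
  "Delta a b c d k =
     256 * (a-k)^3 * k^3 - 192 * (a-k)^2 * b * d * k^2 - 128 * (a-k)^2 * c^2 * k^2
     + 144 * (a-k)^2 * c * d^2 * k - 27 * (a-k)^2 * d^4
     + 144 * (a-k) * b^2 * c * k^2 - 6 * (a-k) * b^2 * d^2 * k - 80 * (a-k) * b * c^2 * d * k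
     + 18 * (a-k) * b * c * d^3 + 16 * (a-k) * c^4 * k
     - 4 * (a-k) * c^3 * d^2 - 27 * b^4 * k^2 + 18 * b^3 * c * d * k - 4 * b^3 * d^3
     - 4 * b^2 * c^3 * k + b^2 * c^2 * d^2"

definition P :: "real \<Rightarrow> real \<Rightarrow> real \<Rightarrow> real \<Rightarrow> real" where
  "P a b c k = 8 * (a-k) * c - 3 * b^2"

definition D :: "real \<Rightarrow> real \<Rightarrow> real \<Rightarrow> real \<Rightarrow> real \<Rightarrow> real" where
  "D a b c d k =
     64 * (a-k)^3 * k - 16 * (a-k)^2 * c^2 + 16 * (a-k) * b^2 * c - 16 * (a-k)^2 * b * d - 3 * b^4"

definition R :: "real \<Rightarrow> real \<Rightarrow> real \<Rightarrow> real \<Rightarrow> real \<Rightarrow> real" where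
  "R a b c d k = b^3 + 8 * d * (a-k)^2 - 4 * (a-k) * b * c"

end

theory Submission
  imports Defs "HOL-Computational_Algebra.Polynomial"
begin

text \<open>Because \<open>ring_input\<close> permutes the cells, the sum of all \<open>x\<^sub>j\<^sup>4\<close> equals the sum of the
  fourth powers of the inputs. Hence \<open>\<langle>Q(x),x\<rangle>\<close> is a sum of values, at the pairs (cell, input), of
  the quartic form \<open>(a-k) y\<^sup>4 + b y\<^sup>3 z + c y\<^sup>2 z\<^sup>2 + d y z\<^sup>3 + k z\<^sup>4\<close>, and it suffices that this
  form is negative definite. As \<open>a - k < 0\<close>, this means that it has no real root. After the
  substitution \<open>u = 4(a-k) y + b z\<close> the quartic is depressed, with coefficients \<open>2P\<close>, \<open>8R\<close> and
  \<open>P\<^sup>2 + 4D\<close>. In the degenerate case it is \<open>(u\<^sup>2 + P)\<^sup>2\<close>. If the discriminant is positive, one real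
  root forces four real roots, and four real roots with sum zero force \<open>P \<le> 0\<close> and \<open>D \<le> 0\<close>.\<close>

lemma depressed_quartic_pos_somewhere:
  fixes p q s v :: real
  shows "\<exists>w\<ge>v. w^4 + p * w^2 + q * w + s > 0"
proof -
  obtain n where "\<forall>x\<ge>n. poly [:s, q, p, 0, 1:] x \<ge> 1"
    using poly_pinfty_gt_lc[of "[:s, q, p, 0, 1:]"] by auto
  then have "poly [:s, q, p, 0, 1:] (max n v) > 0"
    by (meson less_le_trans max.cobounded1 zero_less_one)
  then show ?thesis
    by (intro exI[of _ "max n v"]) (simp add: algebra_simps eval_nat_numeral)
qed

lemma cubic_real_root:
  fixes l m n :: real
  obtains x where "x^3 + l * x^2 + m * x + n = 0"
proof -
  let ?f = "\<lambda>x. x^3 + l * x^2 + m * x + n"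
  obtain u where "\<forall>x\<ge>u. poly [:n, m, l, 1:] x \<ge> 1"
    using poly_pinfty_gt_lc[of "[:n, m, l, 1:]"] by auto
  then have u: "?f x > 0" if "x \<ge> u" for x
    using that by (force simp: algebra_simps eval_nat_numeral)
  \<comment> \<open>This polynomial is \<open>-f(-X)\<close>, so its positivity far to the right
    makes \<open>f\<close> negative far to the left.\<close>
  obtain v where "\<forall>x\<ge>v. poly [:-n, m, -l, 1:] x \<ge> 1"
    using poly_pinfty_gt_lc[of "[:-n, m, -l, 1:]"] by auto
  then have v: "?f (-x) < 0" if "x \<ge> v" for x
    using that by (force simp: algebra_simps eval_nat_numeral)
  have "\<exists>x\<ge>- max \<bar>u\<bar> \<bar>v\<bar>. x \<le> max \<bar>u\<bar> \<bar>v\<bar> \<and> ?f x = 0"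
  proof (rule IVT')
    show "?f (- max \<bar>u\<bar> \<bar>v\<bar>) \<le> 0" using v[of "max \<bar>u\<bar> \<bar>v\<bar>"] by linarith
    show "0 \<le> ?f (max \<bar>u\<bar> \<bar>v\<bar>)" using u[of "max \<bar>u\<bar> \<bar>v\<bar>"] by linarith
  qed (auto intro!: continuous_intros)
  then show ?thesis using that by blast
qed

lemma depressed_quartic_no_real_root:
  fixes p q s x :: real
  assumes disc: "16 * p^4 * s - 4 * p^3 * q^2 - 128 * p^2 * s^2 + 144 * p * q^2 * s
      - 27 * q^4 + 256 * s^3 > 0"
    and ps: "p > 0 \<or> 4 * s - p^2 > 0"
  shows "x^4 + p * x^2 + q * x + s \<noteq> 0"
proof
  assume root: "x^4 + p * x^2 + q * x + s = 0"
  \<comment> \<open>The cubic is the quotient of the quartic by \<open>X - x\<close>; its root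
    \<open>y\<close> is a second real root of the quartic, counted with multiplicity.\<close>
  obtain y where y: "y^3 + x * y^2 + (x^2 + p) * y + (x^3 + p * x + q) = 0"
    by (rule cubic_real_root)
  \<comment> \<open>With \<open>g\<close> and \<open>e\<close> the sum and product of the two roots,
    the quartic factors as \<open>(X^2 - g X + e) (X^2 + g X + f)\<close>; comparing coefficients
    gives \<open>p\<close>, \<open>q\<close> and \<open>s\<close>.\<close>
  define g where "g = x + y"
  define e where "e = x * y"
  define f where "f = p - e + g^2"
  have p: "p = e + f - g^2" by (simp add: f_def)
  have q: "q = g * (e - f)"
    using y by (simp add: f_def e_def g_def) algebra
  have s: "s = e * f"
    using y root unfolding f_def e_def g_def by algebra
  \<comment> \<open>The discriminant of a product is the product of the discriminants of the factors
    times the square of their resultant.\<close>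
  have "16 * p^4 * s - 4 * p^3 * q^2 - 128 * p^2 * s^2 + 144 * p * q^2 * s
      - 27 * q^4 + 256 * s^3 = (g^2 - 4 * e) * (g^2 - 4 * f) * ((e - f)^2 + 2 * g^2 * (e + f))^2"
    unfolding p q s by algebra
  moreover have e: "g^2 - 4 * e = (x - y)^2"
    unfolding e_def g_def by algebra
  ultimately have "(x - y)^2 * (g^2 - 4 * f) * ((e - f)^2 + 2 * g^2 * (e + f))^2 > 0"
    using disc by simp
  then have f: "g^2 - 4 * f > 0"
    by (auto simp: zero_less_mult_iff)
  \<comment> \<open>Both quadratic factors have nonnegative discriminant, so \<open>4 * e\<close>
    and \<open>4 * f\<close> are at most \<open>g^2\<close>.\<close>
  have ef: "e + f \<le> g^2 / 2"
    using e f by (smt (verit) field_sum_of_halves zero_le_power2)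
  then have "p \<le> 0"
    using p by (smt (verit) field_sum_of_halves zero_le_power2)
  moreover have "p^2 - 4 * s = (e - f)^2 + 2 * g^2 * (g^2 / 2 - (e + f))"
    unfolding p s by algebra
  then have "p^2 - 4 * s \<ge> 0"
    using ef by simp
  ultimately show False using ps by linarith
qed

text \<open>A quartic that is positive far to the right and has no real root is positive everywhere,
  by the intermediate value theorem.\<close>

lemma depressed_quartic_pos:
  fixes p q s x :: real
  assumes "16 * p^4 * s - 4 * p^3 * q^2 - 128 * p^2 * s^2 + 144 * p * q^2 * s
      - 27 * q^4 + 256 * s^3 > 0"
    and "p > 0 \<or> 4 * s - p^2 > 0"
  shows "x^4 + p * x^2 + q * x + s > 0"
proof (rule ccontr)
  let ?f = "\<lambda>x. x^4 + p * x^2 + q * x + s"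
  assume "\<not> ?f x > 0"
  moreover obtain w where "w \<ge> x" "?f w > 0"
    using depressed_quartic_pos_somewhere by blast
  ultimately have "\<exists>y\<ge>x. y \<le> w \<and> ?f y = 0"
    by (intro IVT') (auto intro!: continuous_intros)
  then show False
    using depressed_quartic_no_real_root[OF assms] by blast
qed

lemma quartic_neg:
  fixes a b c d k x :: real
  assumes "a < k"
    and "(Delta a b c d k > 0 \<and> (P a b c k > 0 \<or> D a b c d k > 0)) \<or>
       (Delta a b c d k = 0 \<and> D a b c d k = 0 \<and> R a b c d k = 0 \<and> P a b c k > 0)"
  shows "(a - k) * x^4 + b * x^3 + c * x^2 + d * x + k < 0" (is "?F < 0")
proof -
  define A where "A = a - k"
  have A: "A < 0" using assms(1) by (simp add: A_def)
  define p where "p = 2 * P a b c k"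
  define q where "q = 8 * R a b c d k"
  define s where "s = (P a b c k)^2 + 4 * D a b c d k"
  define u where "u = 4 * A * x + b"
  have dep: "256 * A^3 * ?F = u^4 + p * u^2 + q * u + s"
    unfolding p_def q_def s_def u_def P_def R_def D_def A_def[symmetric] by algebra
  \<comment> \<open>The roots in \<open>u\<close> are \<open>4 * A * x + b\<close>, so the squared
    root differences contribute \<open>(4 * A)^12\<close>, while \<open>Delta\<close> already
    carries the factor \<open>A^6\<close> of its leading coefficient; what remains is
    \<open>4^12 * A^6\<close>.\<close>
  have "16 * p^4 * s - 4 * p^3 * q^2 - 128 * p^2 * s^2 + 144 * p * q^2 * s
      - 27 * q^4 + 256 * s^3 = 16777216 * A^6 * Delta a b c d k"
    unfolding p_def q_def s_def P_def R_def D_def Delta_def A_def[symmetric] by algebra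
  moreover have "4 * s - p^2 = 16 * D a b c d k"
    unfolding p_def s_def by algebra
  ultimately have "u^4 + p * u^2 + q * u + s > 0"
    if "Delta a b c d k > 0" "P a b c k > 0 \<or> D a b c d k > 0"
    using that A by (intro depressed_quartic_pos) (auto simp: p_def zero_less_power_eq)
  moreover have "u^4 + p * u^2 + q * u + s > 0"
    if "D a b c d k = 0" "R a b c d k = 0" "P a b c k > 0"
  proof -
    have "u^4 + p * u^2 + q * u + s = (u^2 + P a b c k)^2"
      unfolding p_def q_def s_def that by algebra
    moreover have "u^2 + P a b c k > 0"
      using that by (simp add: add_nonneg_pos)
    ultimately show ?thesis by simp
  qed
  ultimately have "256 * A^3 * ?F > 0"
    using assms(2) dep by metis
  moreover have "A^3 < 0" using A by (simp add: power_less_zero_eq)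
  ultimately show ?thesis
    by (simp add: zero_less_mult_iff)
qed

text \<open>For nonzero \<open>z\<close>, dividing by \<open>z^4\<close> reduces the form to the
  quartic in \<open>y / z\<close>; for \<open>z = 0\<close> only \<open>(a - k) * y^4\<close> is
  left. The term with \<open>k\<close> is kept separate because it cancels when summed over the
  ring.\<close>

lemma quartic_form_neg:
  fixes a b c d k y z :: real
  assumes "a < k"
    and "(Delta a b c d k > 0 \<and> (P a b c k > 0 \<or> D a b c d k > 0)) \<or>
       (Delta a b c d k = 0 \<and> D a b c d k = 0 \<and> R a b c d k = 0 \<and> P a b c k > 0)"
    and "y \<noteq> 0 \<or> z \<noteq> 0"
  shows "q a b c d y z * y + k * (z^4 - y^4) < 0"
proof (cases "z = 0")
  case True
  then have "q a b c d y z * y + k * (z^4 - y^4) = (a - k) * y^4"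
    by (simp add: q_def algebra_simps eval_nat_numeral)
  moreover have "y^4 > 0" using assms(3) True by simp
  ultimately show ?thesis
    using assms(1) by (simp add: mult_neg_pos)
next
  case False
  define x where "x = y / z"
  have y: "y = x * z" using False by (simp add: x_def)
  have "q a b c d y z * y + k * (z^4 - y^4) =
      ((a - k) * x^4 + b * x^3 + c * x^2 + d * x + k) * z^4"
    unfolding q_def y by algebra
  moreover have "z^4 > 0" using False by simp
  ultimately show ?thesis
    using quartic_neg[OF assms(1,2), of x] by (simp add: mult_neg_pos)
qed

text \<open>The input map is the cyclic predecessor on \<open>{1..n}\<close> transported along
  \<open>cell\<close>. The predecessor is injective from a finite set to itself, hence bijective;
  for \<open>n = 1\<close> it is the identity.\<close>

lemma bij_ring_input:
  fixes cell :: "nat \<Rightarrow> 'n::finite"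
  assumes "ring_labelling cell"
  shows "bij (ring_input cell)"
proof -
  let ?n = "CARD('n)"
  let ?i = "inv_into {1..?n} cell"
  let ?pred = "\<lambda>i. if i = 1 then ?n else i - 1"
  have cell: "bij_betw cell {1..?n} UNIV"
    using assms by (simp add: ring_labelling_def)
  have i: "bij_betw ?i UNIV {1..?n}"
    using cell by (rule bij_betw_inv_into)
  have "inj_on ?pred {1..?n}"
    by (auto simp: inj_on_def split: if_splits)
  moreover have "?pred ` {1..?n} \<subseteq> {1..?n}"
    by (auto simp: Suc_le_eq)
  ultimately have "bij_betw ?pred {1..?n} {1..?n}"
    using endo_inj_surj[OF finite_atLeastAtMost] unfolding bij_betw_def by blast
  then have "bij_betw (cell \<circ> (?pred \<circ> ?i)) UNIV UNIV"
    by (intro bij_betw_trans[OF bij_betw_trans[OF i] cell])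
  moreover have "cell \<circ> (?pred \<circ> ?i) = ring_input cell"
    by (auto simp: ring_input_def Let_def)
  ultimately show ?thesis by simp
qed

lemma homogeneous_ring_map:
  "homogeneous_polynomial_map 3 (ring_map cell a b c d)"
proof -
  have nth: "real_polynomial_function (\<lambda>x::real^'a. x $ i)" for i :: 'a
    by (intro real_polynomial_function.intros(1) bounded_linear_vec_nth)
  have "real_polynomial_function (\<lambda>x. ring_map cell a b c d x \<bullet> v)" if "v \<in> Basis" for v
  proof -
    obtain j where v: "v = axis j 1"
      using \<open>v \<in> Basis\<close> by (auto simp: Basis_vec_def)
    show ?thesis
      unfolding v ring_map_def q_def
      by (simp add: inner_axis)
         (intro real_polynomial_function.intros(2-) real_polynomial_function_power nth)
  qed
  then have "polynomial_function (ring_map cell a b c d)"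
    by (subst polynomial_function_iff_Basis_inner) simp
  moreover have "ring_map cell a b c d (t *\<^sub>R x) = t^3 *\<^sub>R ring_map cell a b c d x" for t x
    by (simp add: vec_eq_iff ring_map_def q_def algebra_simps eval_nat_numeral)
  ultimately show ?thesis
    by (simp add: homogeneous_polynomial_map_def)
qed

text \<open>Any \<open>k\<close> may be inserted, since reindexing along the bijection
  \<open>ring_input cell\<close> makes the fourth powers cancel in the sum.\<close>

lemma ring_map_inner:
  fixes cell :: "nat \<Rightarrow> 'n::finite"
  assumes "ring_labelling cell"
  shows "ring_map cell a b c d x \<bullet> x =
    (\<Sum>j\<in>UNIV. q a b c d (x $ j) (x $ ring_input cell j) * x $ j
      + k * ((x $ ring_input cell j)^4 - (x $ j)^4))"
proof -
  have "(\<Sum>j\<in>UNIV. (x $ ring_input cell j)^4) = (\<Sum>j\<in>UNIV. (x $ j)^4)"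
    using bij_ring_input[OF assms] by (rule sum.reindex_bij_betw)
  then show ?thesis
    by (simp add: inner_vec_def ring_map_def sum.distrib sum_subtractf flip: sum_distrib_left)
qed

theorem proposition1:
  fixes a b c d :: real and cell :: "nat \<Rightarrow> 'n::finite"
  assumes "ring_labelling cell"
    and "\<exists>k. a < k \<and> k < 0 \<and>
      ((Delta a b c d k > 0 \<and> (P a b c k > 0 \<or> D a b c d k > 0)) \<or>
       (Delta a b c d k = 0 \<and> D a b c d k = 0 \<and> R a b c d k = 0 \<and> P a b c k > 0))"
  shows "contracting (ring_map cell a b c d)"
proof -
  obtain k where k: "a < k"
    "(Delta a b c d k > 0 \<and> (P a b c k > 0 \<or> D a b c d k > 0)) \<or>
       (Delta a b c d k = 0 \<and> D a b c d k = 0 \<and> R a b c d k = 0 \<and> P a b c k > 0)"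
    using assms(2) by blast
  have "ring_map cell a b c d x \<bullet> x < 0" if "x \<in> sphere 0 1" for x
  proof -
    let ?h = "\<lambda>j. q a b c d (x $ j) (x $ ring_input cell j) * x $ j
      + k * ((x $ ring_input cell j)^4 - (x $ j)^4)"
    have neg: "?h j < 0" if "x $ j \<noteq> 0 \<or> x $ ring_input cell j \<noteq> 0" for j
      using quartic_form_neg[OF k that] .
    \<comment> \<open>A summand vanishes when both the cell and its input are zero, so only weak
      negativity holds for every \<open>j\<close>; a nonzero coordinate of \<open>x\<close> supplies
      one strict inequality.\<close>
    have "?h j \<le> 0" for j
      using neg[of j] by (cases "x $ j \<noteq> 0 \<or> x $ ring_input cell j \<noteq> 0") auto
    moreover have "\<exists>j. ?h j < 0"
    proof -
      have "x \<noteq> 0" using that by auto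
      then obtain j where "x $ j \<noteq> 0"
        by (auto simp: vec_eq_iff)
      then show ?thesis using neg by blast
    qed
    ultimately have "(\<Sum>j\<in>UNIV. ?h j) < (\<Sum>j\<in>(UNIV::'n set). 0)"
      by (intro sum_strict_mono_ex1) auto
    then show ?thesis
      by (simp add: ring_map_inner[OF assms(1), where k = k])
  qed
  moreover have "homogeneous_polynomial_map (2 * 1 + 1) (ring_map cell a b c d)"
    using homogeneous_ring_map by simp
  ultimately show ?thesis
    unfolding contracting_def by blast
qed

end
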